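(* Let $\mathcal{P}$ be an order-hereditary property of $k$-colourings with $\mathcal{P}_n\ne\emptyset$ for every $n\in\mathbb{N}$, and let $\varepsilon>0$. There exist constants $N,n_0\in\mathbb{N}$ and a family $\mathcal{F}$ of $k$-colourings of $E(K_N)$ such that for all $n\ge n_0$: (i) $\mathcal{P}_n\subseteq\mathrm{Forb}(\mathcal{F})_n$, and (ii) $|\mathrm{Forb}(\mathcal{F})_n|\le|\mathcal{P}_n|\,k^{\varepsilon\binom n2}$.
   Context: $K_n$ is the complete graph on $[n]$; a $k$-colouring of $K_n$ is a map $E(K_n)\to[k]$. For $m\le n$, $\binom{K_n}{K_m}$ is the set of order-preserving injections $\phi:[m]\to[n]$; $c_{|\phi}(ij)=c(\phi(i)\phi(j))$. An order-hereditary property is a sequence $(\mathcal{P}_n)$, $\mathcal{P}_n$ a family of $k$-colourings of $K_n$, with $c_{|\phi}\in\mathcal{P}_m$ whenever $c\in\mathcal{P}_n$ and $\phi\in\binom{K_n}{K_m}$. $\mathrm{Forb}(\mathcal{F})_n$ is the set of $k$-colourings $c$ of $K_n$ with $c_{|\phi}\notin\mathcal{F}$ for all $\phi\in\binom{K_n}{K_N}$. *)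

theory Defs
  imports Complex_Main "HOL-Library.FuncSet" "HOL-Library.Ramsey"
begin

definition complete_edges :: "nat \<Rightarrow> nat set set" where
  "complete_edges n = nsets {1..n} 2"

text \<open>
  Colourings are extensional functions, so that each map from the edge set to the colours
  is represented exactly once and cardinalities of sets of colourings are the intended ones.
\<close>

type_synonym colouring = "nat set \<Rightarrow> nat"

definition colourings :: "nat \<Rightarrow> nat \<Rightarrow> colouring set" where
  "colourings k n = complete_edges n \<rightarrow>\<^sub>E {1..k}"

definition order_embeddings :: "nat \<Rightarrow> nat \<Rightarrow> (nat \<Rightarrow> nat) set" where
  "order_embeddings m n = {\<phi> \<in> {1..m} \<rightarrow>\<^sub>E {1..n}. strict_mono_on {1..m} \<phi>}"

definition restrict_colouring :: "nat \<Rightarrow> colouring \<Rightarrow> (nat \<Rightarrow> nat) \<Rightarrow> colouring" where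
  "restrict_colouring m c \<phi> = (\<lambda>e\<in>complete_edges m. c (\<phi> ` e))"

definition order_hereditary :: "nat \<Rightarrow> (nat \<Rightarrow> colouring set) \<Rightarrow> bool" where
  "order_hereditary k P \<longleftrightarrow>
     (\<forall>n. P n \<subseteq> colourings k n) \<and>
     (\<forall>m n. m \<le> n \<longrightarrow>
        (\<forall>c\<in>P n. \<forall>\<phi>\<in>order_embeddings m n. restrict_colouring m c \<phi> \<in> P m))"

text \<open>
  \<open>N\<close> is the order of the forbidden colourings. For \<open>n < N\<close> there are no embeddings, so
  every colouring of the complete graph on \<open>{1..n}\<close> qualifies.
\<close>

definition Forb :: "nat \<Rightarrow> nat \<Rightarrow> colouring set \<Rightarrow> nat \<Rightarrow> colouring set" where
  "Forb k N F n =
     {c \<in> colourings k n. \<forall>\<phi>\<in>order_embeddings N n. restrict_colouring N c \<phi> \<notin> F}"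

end

theory Submission
  imports Defs
begin

text \<open>
  Take for \<open>F\<close> all colourings of \<open>K\<^sub>N\<close> outside \<open>P N\<close>. Shearer's product inequality, applied to the
  edge sets of all \<open>N\<close>-subsets of the vertices, bounds the normalised logarithm
  \<open>ln |Forb\<^sub>n| / (n choose 2)\<close> by \<open>ln |P\<^sub>N| / (N choose 2)\<close>. The latter is within \<open>\<epsilon> ln k\<close> of its
  infimum over all \<open>N \<ge> 2\<close> for a suitable \<open>N\<close>, and the infimum is in turn a lower bound for
  \<open>ln |P\<^sub>n| / (n choose 2)\<close>.
\<close>

section \<open>Mean inequality and a form of Hoelder's inequality\<close>

text \<open>Divide the terms by their mean \<open>m\<close> and multiply the bounds
  \<open>t \<le> exp (t - 1)\<close>: the exponents add up to 0. The case \<open>m = 0\<close> is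
  separate because of the division.\<close>

lemma prod_le_arith_mean_power:
  fixes x :: "'i \<Rightarrow> real"
  assumes "finite T" "T \<noteq> {}" and nonneg: "\<And>i. i \<in> T \<Longrightarrow> 0 \<le> x i"
  shows "(\<Prod>i\<in>T. x i) \<le> ((\<Sum>i\<in>T. x i) / card T) ^ card T"
proof -
  define m where "m = (\<Sum>i\<in>T. x i) / card T"
  have card: "real (card T) > 0"
    using assms by (simp add: card_gt_0_iff)
  have "m \<ge> 0"
    unfolding m_def using nonneg by (simp add: sum_nonneg)
  show ?thesis
  proof (cases "m = 0")
    case True
    then have "\<forall>i\<in>T. x i = 0"
      using card nonneg assms by (simp add: m_def sum_nonneg_eq_0_iff)
    then have "(\<Prod>i\<in>T. x i) = 0"
      using assms by auto
    then show ?thesis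
      using \<open>m \<ge> 0\<close> unfolding m_def by simp
  next
    case False
    with \<open>m \<ge> 0\<close> have "m > 0" by simp
    have "(\<Prod>i\<in>T. x i / m) \<le> (\<Prod>i\<in>T. exp (x i / m - 1))"
    proof (rule prod_mono, intro conjI)
      fix i assume "i \<in> T"
      then show "0 \<le> x i / m" using nonneg \<open>m > 0\<close> by simp
      show "x i / m \<le> exp (x i / m - 1)"
        using exp_ge_add_one_self[of "x i / m - 1"] by simp
    qed
    also have "\<dots> = exp (\<Sum>i\<in>T. x i / m - 1)"
      using assms by (simp add: exp_sum)
    also have "(\<Sum>i\<in>T. x i / m - 1) = 0"
      using card \<open>m > 0\<close>
      by (simp add: sum_subtractf flip: sum_divide_distrib) (auto simp: m_def)
    finally have "(\<Prod>i\<in>T. x i) / m ^ card T \<le> 1"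
      by (simp add: prod_dividef)
    then show ?thesis
      using \<open>m > 0\<close> unfolding m_def[symmetric] by (simp add: divide_le_eq)
  qed
qed

text \<open>Hoelder's inequality in the form used by the induction step for Shearer's inequality.
  After division by \<open>b i\<close>, the indices in \<open>T\<close> carry the averaging, while
  those outside \<open>T\<close> only contribute factors of at most 1.\<close>

lemma sum_power_le_prod_of_pointwise:
  fixes a :: "'i \<Rightarrow> 'x \<Rightarrow> real" and b :: "'i \<Rightarrow> real" and u :: "'x \<Rightarrow> real"
  assumes "finite I" "T \<subseteq> I" "T \<noteq> {}" "finite X"
    and a: "\<And>i x. i \<in> I \<Longrightarrow> x \<in> X \<Longrightarrow> 0 \<le> a i x"
    and le: "\<And>i x. i \<in> I \<Longrightarrow> x \<in> X \<Longrightarrow> a i x \<le> b i"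
    and sum: "\<And>i. i \<in> T \<Longrightarrow> (\<Sum>x\<in>X. a i x) = b i"
    and b: "\<And>i. i \<in> I \<Longrightarrow> 0 < b i"
    and u: "\<And>x. x \<in> X \<Longrightarrow> 0 \<le> u x"
    and pointwise: "\<And>x. x \<in> X \<Longrightarrow> u x ^ card T \<le> (\<Prod>i\<in>I. a i x)"
  shows "(\<Sum>x\<in>X. u x) ^ card T \<le> (\<Prod>i\<in>I. b i)"
proof -
  define B where "B = (\<Prod>i\<in>I. b i)"
  define d where "d = card T"
  define \<beta> where "\<beta> = root d B"
  define m where "m x = (\<Sum>i\<in>T. a i x / b i) / d" for x
  have "finite T" using assms finite_subset by blast
  then have "d > 0" using assms by (simp add: d_def card_gt_0_iff)
  have "B > 0" unfolding B_def using b by (simp add: prod_pos)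
  have \<beta>: "\<beta> \<ge> 0" "\<beta> ^ d = B"
    using \<open>B > 0\<close> \<open>d > 0\<close> by (auto simp: \<beta>_def)
  \<comment> \<open>The mean inequality over \<open>T\<close> gives
    \<open>u x ^ d \<le> B * m x ^ d\<close>. Taking \<open>d\<close>-th roots makes the bound
    linear, so that it can be summed over \<open>X\<close>.\<close>
  have "u x \<le> \<beta> * m x" if "x \<in> X" for x
  proof -
    have m0: "m x \<ge> 0"
      unfolding m_def using assms(2) a[OF _ that] less_imp_le[OF b]
      by (intro divide_nonneg_nonneg sum_nonneg) auto
    have "u x ^ d \<le> (\<Prod>i\<in>I. a i x)"
      using pointwise that by (simp add: d_def)
    also have "\<dots> = B * (\<Prod>i\<in>I. a i x / b i)"
      using \<open>B > 0\<close> by (simp add: B_def prod_dividef)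
    also have "(\<Prod>i\<in>I. a i x / b i) = (\<Prod>i\<in>T. a i x / b i) * (\<Prod>i\<in>I - T. a i x / b i)"
      using assms by (subst prod.subset_diff[of T I]) (auto simp: mult.commute)
    also have "\<dots> \<le> (\<Prod>i\<in>T. a i x / b i) * 1"
    proof (rule mult_left_mono)
      show "(\<Prod>i\<in>I - T. a i x / b i) \<le> 1"
        using a[OF _ that] le[OF _ that] b
        by (intro prod_le_1) (auto intro!: divide_nonneg_pos simp: divide_le_eq)
      show "0 \<le> (\<Prod>i\<in>T. a i x / b i)"
        using a[OF _ that] less_imp_le[OF b] assms(2)
        by (intro prod_nonneg divide_nonneg_nonneg) auto
    qed
    also have "(\<Prod>i\<in>T. a i x / b i) * 1 \<le> m x ^ d"
      unfolding m_def d_def mult_1_right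
      using \<open>finite T\<close> assms(2,3) a[OF _ that] less_imp_le[OF b]
      by (intro prod_le_arith_mean_power divide_nonneg_nonneg) auto
    finally have "u x ^ d \<le> (\<beta> * m x) ^ d"
      using \<open>B > 0\<close> \<beta> by (simp add: power_mult_distrib)
    then show ?thesis
      using \<beta> m0 \<open>d > 0\<close> u that by (simp add: power_mono_iff)
  qed
  then have "(\<Sum>x\<in>X. u x) \<le> (\<Sum>x\<in>X. \<beta> * m x)"
    by (rule sum_mono)
  also have "\<dots> = \<beta> * ((\<Sum>i\<in>T. \<Sum>x\<in>X. a i x / b i) / d)"
    unfolding m_def by (subst sum.swap) (simp add: sum_distrib_left sum_divide_distrib)
  \<comment> \<open>For each \<open>i\<close> in \<open>T\<close> the ratios form a probability
    distribution on \<open>X\<close>, hence so does their average \<open>m\<close>.\<close>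
  also have "(\<Sum>i\<in>T. \<Sum>x\<in>X. a i x / b i) = (\<Sum>i\<in>T. 1)"
  proof (rule sum.cong[OF refl])
    fix i assume "i \<in> T"
    then have "b i > 0" using b assms(2) by blast
    then show "(\<Sum>x\<in>X. a i x / b i) = 1"
      using sum[OF \<open>i \<in> T\<close>] by (simp flip: sum_divide_distrib)
  qed
  also have "\<beta> * ((\<Sum>i\<in>T. 1) / d) = \<beta>"
    using \<open>d > 0\<close> by (simp add: d_def)
  finally have "(\<Sum>x\<in>X. u x) ^ d \<le> \<beta> ^ d"
    using u by (intro power_mono sum_nonneg) auto
  then show ?thesis
    using \<beta> by (simp add: B_def d_def)
qed

section \<open>Shearer's product inequality\<close>

text \<open>Since \<open>e\<close> lies in \<open>S\<close>, a restriction to \<open>S\<close> still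
  shows the value at \<open>e\<close>, so different fibres have disjoint images.\<close>

lemma card_restrict_image_eq_sum_fibres:
  assumes "finite A" "e \<in> S"
  shows "card ((\<lambda>f. restrict f S) ` A) =
    (\<Sum>x\<in>(\<lambda>f. f e) ` A. card ((\<lambda>f. restrict f S) ` {f \<in> A. f e = x}))"
proof -
  have "(\<lambda>f. restrict f S) ` A = (\<Union>x\<in>(\<lambda>f. f e) ` A. (\<lambda>f. restrict f S) ` {f \<in> A. f e = x})"
    by auto
  also have "card \<dots> = (\<Sum>x\<in>(\<lambda>f. f e) ` A. card ((\<lambda>f. restrict f S) ` {f \<in> A. f e = x}))"
  proof (rule card_UN_disjoint)
    show "\<forall>x\<in>(\<lambda>f. f e) ` A. \<forall>y\<in>(\<lambda>f. f e) ` A. x \<noteq> y \<longrightarrow>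
      (\<lambda>f. restrict f S) ` {f \<in> A. f e = x} \<inter> (\<lambda>f. restrict f S) ` {f \<in> A. f e = y} = {}"
      using assms(2) by (auto dest!: fun_cong[where x = e])
  qed (use assms in auto)
  finally show ?thesis .
qed

text \<open>
  Induction on \<open>E\<close>: split \<open>A\<close> according to the value at the new point, apply the induction
  hypothesis to every fibre, and recombine by Hoelder's inequality over \<open>d\<close> of the sets
  \<open>S i\<close> that contain this point.
\<close>

theorem Shearer_product_inequality:
  fixes A :: "('e \<Rightarrow> 'c) set" and S :: "'i \<Rightarrow> 'e set"
  assumes "finite E" "finite A" "finite I" "d > 0"
    and "\<And>e. e \<in> E \<Longrightarrow> d \<le> card {i \<in> I. e \<in> S i}"
  shows "card ((\<lambda>f. restrict f E) ` A) ^ d \<le> (\<Prod>i\<in>I. card ((\<lambda>f. restrict f (S i)) ` A))"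
  using assms(1,2,5)
proof (induction E arbitrary: A rule: finite_induct)
  case (empty A)
  show ?case
  proof (cases "A = {}")
    case False
    have "(\<lambda>f. restrict f {}) ` A = {\<lambda>x. undefined}"
      using False by (auto simp: restrict_def)
    moreover have "1 \<le> (\<Prod>i\<in>I. card ((\<lambda>f. restrict f (S i)) ` A))"
      using False empty by (intro prod_ge_1) (simp add: Suc_le_eq card_gt_0_iff)
    ultimately show ?thesis by (metis card_1_singleton_iff One_nat_def power_one)
  qed (use \<open>d > 0\<close> in \<open>simp add: zero_power\<close>)
next
  case (insert e E A)
  show ?case
  proof (cases "A = {}")
    case False
    \<comment> \<open>Exactly \<open>d\<close> of the sets through \<open>e\<close> are kept, so
      that the Hoelder exponent is \<open>d\<close>. For all other indices the bound
      \<open>a i x \<le> b i\<close> suffices.\<close>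
    obtain T where T: "T \<subseteq> {i \<in> I. e \<in> S i}" "card T = d"
      using insert.prems(2)[of e] obtain_subset_with_card_n by (metis insertI1)
    define X where "X = (\<lambda>f. f e) ` A"
    define fib where "fib x = {f \<in> A. f e = x}" for x
    define a where "a i x = card ((\<lambda>f. restrict f (S i)) ` fib x)" for i x
    define b where "b i = card ((\<lambda>f. restrict f (S i)) ` A)" for i
    define u where "u x = card ((\<lambda>f. restrict f (insert e E)) ` fib x)" for x
    have fin: "finite (fib x)" for x
      using insert.prems(1) by (simp add: fib_def)
    \<comment> \<open>The value at \<open>e\<close> is \<open>x\<close> on the whole fibre, so
      forgetting it loses nothing.\<close>
    have u_le: "u x \<le> card ((\<lambda>f. restrict f E) ` fib x)" for x
    proof -
      have "(\<lambda>f. restrict f (insert e E)) ` fib x = (\<lambda>g. g(e := x)) ` (\<lambda>f. restrict f E) ` fib x"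
        unfolding image_image by (rule image_cong) (auto simp: fib_def fun_eq_iff restrict_def)
      then show ?thesis
        unfolding u_def using fin by (metis card_image_le finite_imageI)
    qed
    have "(\<Sum>x\<in>X. real (u x)) ^ card T \<le> (\<Prod>i\<in>I. real (b i))"
    proof (rule sum_power_le_prod_of_pointwise[where a = "\<lambda>i x. real (a i x)"])
      show "T \<subseteq> I" "T \<noteq> {}" using T \<open>d > 0\<close> by auto
      show "finite X" using insert.prems(1) by (simp add: X_def)
      show "real (a i x) \<le> real (b i)" for i x
        unfolding a_def b_def of_nat_le_iff
        by (intro card_mono image_mono) (use insert.prems(1) in \<open>auto simp: fib_def\<close>)
      show "(\<Sum>x\<in>X. real (a i x)) = real (b i)" if "i \<in> T" for i
        unfolding a_def b_def X_def fib_def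
        using card_restrict_image_eq_sum_fibres[of A e "S i"] that T insert.prems(1) by auto
      show "0 < real (b i)" for i
        using False insert.prems(1) by (simp add: b_def card_gt_0_iff)
      show "real (u x) ^ card T \<le> (\<Prod>i\<in>I. real (a i x))" for x
      proof -
        have "u x ^ d \<le> card ((\<lambda>f. restrict f E) ` fib x) ^ d"
          using u_le by (rule power_mono) simp
        also have "\<dots> \<le> (\<Prod>i\<in>I. a i x)"
          unfolding a_def using insert.prems(2) fin by (intro insert.IH) auto
        finally show ?thesis
          unfolding T(2) by (metis of_nat_le_iff of_nat_power of_nat_prod)
      qed
    qed (use assms in auto)
    moreover have "card ((\<lambda>f. restrict f (insert e E)) ` A) = (\<Sum>x\<in>X. u x)"
      unfolding u_def X_def fib_def
      using insert.prems(1) by (intro card_restrict_image_eq_sum_fibres) auto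
    ultimately show ?thesis
      unfolding T(2) b_def by (metis of_nat_le_iff of_nat_power of_nat_prod of_nat_sum)
  qed (use \<open>d > 0\<close> in \<open>simp add: zero_power\<close>)
qed

section \<open>Vertex subsets, edges and order embeddings\<close>

text \<open>Adding both ends of \<open>e\<close> to \<open>N - 2\<close> other vertices gives
  distinct \<open>N\<close>-sets. The bound is the covering multiplicity that enters Shearer's
  inequality.\<close>

lemma binomial_le_card_nsets_containing_edge:
  assumes "e \<in> nsets {1..n} 2" "2 \<le> N"
  shows "(n - 2) choose (N - 2) \<le> card {S \<in> nsets {1..n} N. e \<in> nsets S 2}"
proof -
  have e: "e \<subseteq> {1..n}" "finite e" "card e = 2"
    using assms(1) by (auto simp: nsets_def)
  have "(n - 2) choose (N - 2) = card (nsets ({1..n} - e) (N - 2))"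
    using e by (simp add: card_Diff_subset)
  also have "\<dots> \<le> card {S \<in> nsets {1..n} N. e \<in> nsets S 2}"
  proof (rule card_inj_on_le[where f = "\<lambda>T. T \<union> e"])
    show "inj_on (\<lambda>T. T \<union> e) (nsets ({1..n} - e) (N - 2))"
      by (auto simp: inj_on_def nsets_def)
    show "(\<lambda>T. T \<union> e) ` nsets ({1..n} - e) (N - 2) \<subseteq> {S \<in> nsets {1..n} N. e \<in> nsets S 2}"
    proof clarify
      fix T assume "T \<in> nsets ({1..n} - e) (N - 2)"
      then have "T \<subseteq> {1..n}" "finite T" "card T = N - 2" "T \<inter> e = {}"
        by (auto simp: nsets_def)
      then have "card (T \<union> e) = N" using e assms(2) by (simp add: card_Un_disjoint)
      with e \<open>T \<subseteq> {1..n}\<close> \<open>finite T\<close> show "T \<union> e \<in> nsets {1..n} N \<and> e \<in> nsets (T \<union> e) 2"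
        by (auto simp: nsets_def)
    qed
    show "finite {S \<in> nsets {1..n} N. e \<in> nsets S 2}"
      by (simp add: finite_imp_finite_nsets)
  qed
  finally show ?thesis .
qed

lemma finite_colourings: "finite (colourings k n)"
  unfolding colourings_def complete_edges_def
  by (intro finite_PiE finite_imp_finite_nsets) auto

lemma image_in_complete_edges:
  assumes "\<phi> \<in> order_embeddings m n" "e \<in> complete_edges m"
  shows "\<phi> ` e \<in> complete_edges n"
proof -
  have "inj_on \<phi> {1..m}" "\<phi> ` {1..m} \<subseteq> {1..n}"
    using assms(1) by (auto simp: order_embeddings_def intro: strict_mono_on_imp_inj_on)
  then show ?thesis
    using assms(2) unfolding complete_edges_def nsets_def
    by (auto simp: card_image inj_on_subset)
qed

lemma restrict_colouring_in_colourings: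
  assumes "c \<in> colourings k n" "\<phi> \<in> order_embeddings m n"
  shows "restrict_colouring m c \<phi> \<in> colourings k m"
  using assms image_in_complete_edges[OF assms(2)]
  unfolding colourings_def restrict_colouring_def by (auto simp: PiE_iff)

lemma obtain_order_embedding_onto:
  assumes "S \<in> nsets {1..n} N"
  obtains \<phi> where "\<phi> \<in> order_embeddings N n" "\<phi> ` {1..N} = S"
proof -
  have S: "S \<subseteq> {1..n}" "finite S" "card S = N"
    using assms by (auto simp: nsets_def)
  obtain h where h: "bij_betw h {..<N} S" "strict_mono_on {..<N} h"
    using ex_bij_betw_strict_mono_card[OF S(2)] S(3) by metis
  \<comment> \<open>The increasing enumeration \<open>h\<close> of \<open>S\<close> starts at 0,
    whereas vertices are numbered from 1.\<close>
  define \<phi> where "\<phi> = (\<lambda>i\<in>{1..N}. h (i - 1))"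
  have "(\<lambda>i. i - 1) ` {1..N} = {..<N}"
    by (auto simp: image_iff intro!: bexI[of _ "Suc _"])
  then have img: "\<phi> ` {1..N} = S"
    unfolding \<phi>_def image_restrict_eq using h(1)
    by (metis bij_betw_imp_surj_on image_image)
  moreover have "strict_mono_on {1..N} \<phi>"
    by (auto simp: \<phi>_def intro!: strict_mono_onI strict_mono_onD[OF h(2)])
  moreover have "\<phi> \<in> {1..N} \<rightarrow>\<^sub>E {1..n}"
    using img S(1) by (auto simp: \<phi>_def)
  ultimately show thesis
    using that by (auto simp: order_embeddings_def)
qed

section \<open>Counting colourings by their restrictions\<close>

text \<open>In Shearer's inequality for the edge sets of the \<open>N\<close>-subsets, each of the
  \<open>n choose N\<close> factors is at most \<open>card B\<close>: the order embedding onto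
  \<open>S\<close> identifies the traces of \<open>A\<close> on the edges inside \<open>S\<close>
  with members of \<open>B\<close>.\<close>

lemma card_power_le_of_restrictions_in:
  assumes A: "A \<subseteq> colourings k n" and "finite B" "2 \<le> N" "N \<le> n"
    and restr: "\<And>c \<phi>. c \<in> A \<Longrightarrow> \<phi> \<in> order_embeddings N n \<Longrightarrow> restrict_colouring N c \<phi> \<in> B"
  shows "card A ^ ((n - 2) choose (N - 2)) \<le> card B ^ (n choose N)"
proof -
  have "finite A" using A finite_colourings finite_subset by blast
  \<comment> \<open>Colourings are extensional, so restricting them to all edges changes
    nothing.\<close>
  have "(\<lambda>f. restrict f (complete_edges n)) ` A = A"
  proof -
    have "restrict f (complete_edges n) = f" if "f \<in> A" for f
      using that A by (intro extensional_restrict) (auto simp: colourings_def PiE_iff)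
    then show ?thesis by simp
  qed
  then have "card A ^ ((n - 2) choose (N - 2)) =
      card ((\<lambda>f. restrict f (complete_edges n)) ` A) ^ ((n - 2) choose (N - 2))"
    by simp
  also have "\<dots> \<le> (\<Prod>S\<in>nsets {1..n} N. card ((\<lambda>f. restrict f (nsets S 2)) ` A))"
    using \<open>finite A\<close> \<open>2 \<le> N\<close> \<open>N \<le> n\<close>
    by (intro Shearer_product_inequality binomial_le_card_nsets_containing_edge)
      (auto simp: complete_edges_def finite_imp_finite_nsets)
  also have "\<dots> \<le> (\<Prod>S\<in>nsets {1..n} N. card B)"
  proof (rule prod_mono, intro conjI)
    fix S assume "S \<in> nsets {1..n} N"
    then obtain \<phi> where \<phi>: "\<phi> \<in> order_embeddings N n" "\<phi> ` {1..N} = S"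
      by (rule obtain_order_embedding_onto)
    have inj: "inj_on \<phi> {1..N}"
      using \<phi>(1) by (auto simp: order_embeddings_def intro: strict_mono_on_imp_inj_on)
    \<comment> \<open>Pullback along \<open>\<phi>\<close>. It is injective on the traces because
      \<open>\<phi>\<close> maps the edges of \<open>K\<^sub>N\<close> onto those inside
      \<open>S\<close> and traces are extensional.\<close>
    define r where "r g = (\<lambda>e\<in>complete_edges N. g (\<phi> ` e))" for g :: colouring
    have sub: "(`) \<phi> ` complete_edges N = nsets S 2"
      using bij_betw_nsets[of \<phi> "{1..N}" S 2] inj \<phi>(2)
      by (auto simp: bij_betw_def complete_edges_def)
    have r: "r (restrict f (nsets S 2)) = restrict_colouring N f \<phi>" for f
      unfolding r_def restrict_colouring_def using sub by (intro restrict_ext) auto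
    show "card ((\<lambda>f. restrict f (nsets S 2)) ` A) \<le> card B"
    proof (rule card_inj_on_le)
      show "inj_on r ((\<lambda>f. restrict f (nsets S 2)) ` A)"
      proof (rule inj_onI)
        fix g h assume gh: "g \<in> (\<lambda>f. restrict f (nsets S 2)) ` A"
          "h \<in> (\<lambda>f. restrict f (nsets S 2)) ` A" and eq: "r g = r h"
        show "g = h"
        proof (rule extensionalityI[of _ "nsets S 2"])
          fix e assume "e \<in> nsets S 2"
          then obtain e' where "e' \<in> complete_edges N" "e = \<phi> ` e'"
            using sub by blast
          then show "g e = h e"
            using fun_cong[OF eq, of e'] by (simp add: r_def)
        qed (use gh in auto)
      qed
      show "r ` (\<lambda>f. restrict f (nsets S 2)) ` A \<subseteq> B"
        using restr \<phi>(1) by (auto simp: r)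
    qed fact
  qed simp
  also have "\<dots> = card B ^ (n choose N)"
    by simp
  finally show ?thesis .
qed

text \<open>Take logarithms. Counting pairs of an \<open>N\<close>-set and an edge inside it in two
  ways gives \<open>(n choose N) * (N choose 2) = (n choose 2) * d\<close>, which turns the
  exponents into the two normalisations.\<close>

corollary ln_card_le_of_restrictions_in:
  assumes A: "A \<subseteq> colourings k n" and "A \<noteq> {}" and "finite B" "2 \<le> N" "N \<le> n"
    and restr: "\<And>c \<phi>. c \<in> A \<Longrightarrow> \<phi> \<in> order_embeddings N n \<Longrightarrow> restrict_colouring N c \<phi> \<in> B"
  shows "ln (card A) \<le> ln (card B) / (N choose 2) * (n choose 2)"
proof -
  define d where "d = (n - 2) choose (N - 2)"
  have "d > 0" using assms by (simp add: d_def)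
  have N2: "N choose 2 > 0" using \<open>2 \<le> N\<close> by simp
  have "finite A" using A finite_colourings finite_subset by blast
  with \<open>A \<noteq> {}\<close> have "card A > 0" by (simp add: card_gt_0_iff)
  have pw: "card A ^ d \<le> card B ^ (n choose N)"
    unfolding d_def using assms by (intro card_power_le_of_restrictions_in) auto
  moreover have "card A ^ d > 0" using \<open>card A > 0\<close> by simp
  ultimately have "card B ^ (n choose N) > 0" by linarith
  \<comment> \<open>\<open>N \<le> n\<close> makes the exponent \<open>n choose N\<close> positive,
    so \<open>card B = 0\<close> would make the power vanish.\<close>
  then have "card B > 0"
    using \<open>N \<le> n\<close> by (auto simp: zero_less_power_eq)
  have "real (card A) ^ d \<le> real (card B) ^ (n choose N)"
    using pw by (metis of_nat_le_iff of_nat_power)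
  then have "ln (real (card A) ^ d) \<le> ln (real (card B) ^ (n choose N))"
    using \<open>card A > 0\<close> by (intro ln_mono) auto
  then have "d * ln (card A) \<le> (n choose N) * ln (card B)"
    using \<open>card A > 0\<close> \<open>card B > 0\<close> by (simp add: ln_realpow)
  then have "(N choose 2) * (d * ln (card A)) \<le> (N choose 2) * ((n choose N) * ln (card B))"
    by (intro mult_left_mono) auto
  also have "\<dots> = real ((n choose N) * (N choose 2)) * ln (card B)"
    by simp
  also have "(n choose N) * (N choose 2) = (n choose 2) * d"
    unfolding d_def using assms by (intro choose_mult) auto
  finally have "d * ((N choose 2) * ln (card A)) \<le> d * ((n choose 2) * ln (card B))"
    by (simp add: mult_ac)
  then have "(N choose 2) * ln (card A) \<le> (n choose 2) * ln (card B)"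
    using \<open>d > 0\<close> by simp
  then show ?thesis
    using N2 by (simp add: field_simps)
qed

section \<open>Approximation of a hereditary property\<close>

lemma hereditary_subset_Forb:
  assumes "order_hereditary k P" "N \<le> n"
  shows "P n \<subseteq> Forb k N (colourings k N - P N) n"
  using assms unfolding order_hereditary_def Forb_def by blast

text \<open>The forbidden family is a complement within all colourings of \<open>K\<^sub>N\<close>,
  so avoiding it forces membership in \<open>B\<close>. This supplies the restriction condition of
  the logarithmic bound.\<close>

lemma restrict_Forb_complement:
  assumes "c \<in> Forb k N (colourings k N - B) n" "\<phi> \<in> order_embeddings N n"
  shows "restrict_colouring N c \<phi> \<in> B"
  using assms restrict_colouring_in_colourings unfolding Forb_def by blast

theorem theorem2p13:
  fixes k :: nat and P :: "nat \<Rightarrow> colouring set" and \<epsilon> :: real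
  assumes "order_hereditary k P"
    and "\<And>n. P n \<noteq> {}"
    and "\<epsilon> > 0"
  shows "\<exists>N n0 :: nat. \<exists>F. F \<subseteq> colourings k N \<and>
           (\<forall>n\<ge>n0. P n \<subseteq> Forb k N F n \<and>
              real (card (Forb k N F n)) \<le>
                real (card (P n)) * real k powr (\<epsilon> * real (n choose 2)))"
proof -
  have P_sub: "P n \<subseteq> colourings k n" for n
    using assms(1) by (simp add: order_hereditary_def)
  have fin: "finite (P n)" for n
    using P_sub finite_colourings finite_subset by blast
  have card_P: "card (P n) \<ge> 1" for n
    using fin assms(2) by (simp add: Suc_le_eq card_gt_0_iff)
  \<comment> \<open>A member of \<open>P 2\<close> has to colour the edge
    \<open>{1, 2}\<close>.\<close>
  have "k \<noteq> 0"
  proof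
    assume "k = 0"
    obtain c where "c \<in> colourings k 2"
      using assms(2)[of 2] P_sub[of 2] by auto
    moreover have "{1, 2} \<in> complete_edges 2"
      by (simp add: complete_edges_def)
    ultimately show False
      using \<open>k = 0\<close> by (auto simp: colourings_def PiE_iff)
  qed
  define F where "F N = colourings k N - P N" for N
  have sub: "P n \<subseteq> Forb k N (F N) n" if "N \<le> n" for N n
    unfolding F_def using assms(1) that by (rule hereditary_subset_Forb)
  have "\<exists>N. \<forall>n\<ge>N. real (card (Forb k N (F N) n)) \<le>
          real (card (P n)) * real k powr (\<epsilon> * real (n choose 2))"
  \<comment> \<open>For \<open>k = 1\<close> the slack \<open>\<epsilon> * ln k\<close> is 0, so a
    near-minimiser need not exist; but then each \<open>K\<^sub>n\<close> has a single colouring and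
    \<open>N = 0\<close> works.\<close>
  proof (cases "k = 1")
    case True
    have "card (Forb k 0 (F 0) n) \<le> card (P n)" for n
    proof -
      have "card (Forb k 0 (F 0) n) \<le> card (colourings k n)"
        by (rule card_mono) (auto simp: finite_colourings Forb_def)
      also have "\<dots> = 1"
        unfolding colourings_def complete_edges_def
        by (subst card_PiE) (auto simp: True finite_imp_finite_nsets)
      also have "\<dots> \<le> card (P n)" by (rule card_P)
      finally show ?thesis .
    qed
    then show ?thesis using True by auto
  next
    case False
    \<comment> \<open>The infimum is taken from 2 on because \<open>n choose 2\<close> is 0 below
      that.\<close>
    define r where "r n = ln (card (P n)) / (n choose 2)" for n
    have "bdd_below (r ` {2..})"
      unfolding r_def using card_P by (intro bdd_belowI2[of _ 0]) simp
    define h where "h = Inf (r ` {2..})"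
    have "\<epsilon> * ln k > 0"
      using assms(3) False \<open>k \<noteq> 0\<close> by simp
    then have "Inf (r ` {2..}) < h + \<epsilon> * ln k"
      by (simp add: h_def)
    \<comment> \<open>The slack is the logarithm of the allowed factor
      \<open>k powr (\<epsilon> * (n choose 2))\<close>, divided by
      \<open>n choose 2\<close>.\<close>
    then obtain N where N: "N \<ge> 2" "r N < h + \<epsilon> * ln k"
      using cInf_lessD[of "r ` {2..}"] by auto
    have "real (card (Forb k N (F N) n)) \<le>
          real (card (P n)) * real k powr (\<epsilon> * real (n choose 2))" if "n \<ge> N" for n
    proof -
      let ?Q = "Forb k N (F N) n"
      have Q: "?Q \<subseteq> colourings k n" by (auto simp: Forb_def)
      have "?Q \<noteq> {}" using sub[OF that] assms(2)[of n] by auto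
      then have "card ?Q > 0"
        using Q finite_colourings finite_subset by (metis card_gt_0_iff)
      have n2: "real (n choose 2) > 0" using N that by simp
      have "ln (card ?Q) \<le> r N * (n choose 2)"
        unfolding r_def using Q \<open>?Q \<noteq> {}\<close> fin N(1) that
        by (rule ln_card_le_of_restrictions_in) (auto simp: F_def dest: restrict_Forb_complement)
      also have "\<dots> \<le> (h + \<epsilon> * ln k) * (n choose 2)"
        using N by (intro mult_right_mono) auto
      also have "\<dots> \<le> (r n + \<epsilon> * ln k) * (n choose 2)"
      proof -
        \<comment> \<open>From \<open>n \<ge> N \<ge> 2\<close>, the value \<open>r n\<close> is
          among those over which the infimum is taken.\<close>
        have "h \<le> r n"
          unfolding h_def using \<open>bdd_below _\<close> N that by (intro cInf_lower) auto
        then show ?thesis by (intro mult_right_mono) auto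
      qed
      also have "\<dots> = ln (card (P n)) + \<epsilon> * (n choose 2) * ln k"
        using n2 by (simp add: r_def field_simps)
      finally have "exp (ln (card ?Q)) \<le> exp (ln (card (P n)) + \<epsilon> * (n choose 2) * ln k)"
        by simp
      then show ?thesis
        using \<open>card ?Q > 0\<close> card_P[of n] \<open>k \<noteq> 0\<close> by (simp add: exp_add powr_def)
    qed
    then show ?thesis by blast
  qed
  then obtain N where "\<forall>n\<ge>N. real (card (Forb k N (F N) n)) \<le>
          real (card (P n)) * real k powr (\<epsilon> * real (n choose 2))" by blast
  \<comment> \<open>The threshold \<open>n0\<close> is \<open>N\<close> itself.\<close>
  with sub show ?thesis
    by (intro exI[of _ N] exI[of _ "F N"]) (auto simp: F_def)
qed

end
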